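(* Let $Y$ be a real Banach space and $M$ a complete pointed metric space containing a pairly distanced sequence. Then $\mathrm{A}(M,Y)=\mathrm{Lip}_0(M,Y)$ if and only if $Y$ is finite-dimensional.
   Context: Throughout, metric spaces are complete and pointed, with base point $0$. $\mathrm{Lip}_0(M,Y)$ is the Banach space of Lipschitz maps $f:M\to Y$ with $f(0)=0$, normed by $\|f\|=\sup_{p\neq q}\|f(p)-f(q)\|/d(p,q)$. A map $f$ attains its norm toward $y\in Y$ if there is a sequence $(p_n,q_n)$ in $M\times M$ with $p_n\neq q_n$ such that $[f(p_n)-f(q_n)]/d(p_n,q_n)\to y$ and $\|y\|=\|f\|$; $\mathrm{A}(M,Y)$ is the set of $f$ attaining their norm toward some vector. A sequence $(x_n)$ of distinct points of $M$ is pairly distanced if there is a sequence $(r_n)\subseteq[0,1]$ such that for all $j\neq k$ in $\mathbb{N}$: (i) $d(x_{2j-1},x_{2k-1})\ge r_j d(x_{2j-1},x_{2j})+r_k d(x_{2k-1},x_{2k})$; (ii) $d(x_{2j-1},x_{2k})\ge r_j d(x_{2j-1},x_{2j})+(1-r_k)d(x_{2k-1},x_{2k})$; (iii) $d(x_{2j},x_{2k})\ge (1-r_j)d(x_{2j-1},x_{2j})+(1-r_k)d(x_{2k-1},x_{2k})$. *)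

theory Defs
  imports "HOL-Analysis.Analysis"
begin

text \<open>Metric spaces are types of class metric_space (complete via complete_space); the
base point is an explicit element x0. Y is a real Banach space (class banach).\<close>

definition Lip0 :: "'a::metric_space \<Rightarrow> ('a \<Rightarrow> 'b::real_normed_vector) set" where
  "Lip0 x0 = {f. (\<exists>C. C-lipschitz_on UNIV f) \<and> f x0 = 0}"

text \<open>Lipschitz norm: sup of the difference quotients over distinct pairs.\<close>
definition lip_norm :: "('a::metric_space \<Rightarrow> 'b::real_normed_vector) \<Rightarrow> real" where
  "lip_norm f = Sup {norm (f p - f q) / dist p q | p q. p \<noteq> q}"

definition attains_norm_toward :: "('a::metric_space \<Rightarrow> 'b::real_normed_vector) \<Rightarrow> 'b \<Rightarrow> bool" where
  "attains_norm_toward f y \<longleftrightarrow>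
     (\<exists>p q :: nat \<Rightarrow> 'a. (\<forall>n. p n \<noteq> q n) \<and>
        ((\<lambda>n. (1 / dist (p n) (q n)) *\<^sub>R (f (p n) - f (q n))) \<longlongrightarrow> y) sequentially \<and>
        norm y = lip_norm f)"

definition A_set :: "'a::metric_space \<Rightarrow> ('a \<Rightarrow> 'b::real_normed_vector) set" where
  "A_set x0 = {f \<in> Lip0 x0. \<exists>y. attains_norm_toward f y}"

text \<open>Pairly distanced sequence, re-indexed from 0: the pairs are (x (2j), x (2j+1)),
 corresponding to (x_{2j-1}, x_{2j}) in the paper with j shifted by one.\<close>
definition pairly_distanced :: "(nat \<Rightarrow> 'a::metric_space) \<Rightarrow> bool" where
  "pairly_distanced x \<longleftrightarrow> inj x \<and>
     (\<exists>r :: nat \<Rightarrow> real. (\<forall>n. 0 \<le> r n \<and> r n \<le> 1) \<and>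
       (\<forall>j k. j \<noteq> k \<longrightarrow>
          dist (x (2*j)) (x (2*k)) \<ge> r j * dist (x (2*j)) (x (2*j+1)) + r k * dist (x (2*k)) (x (2*k+1)) \<and>
          dist (x (2*j)) (x (2*k+1)) \<ge> r j * dist (x (2*j)) (x (2*j+1)) + (1 - r k) * dist (x (2*k)) (x (2*k+1)) \<and>
          dist (x (2*j+1)) (x (2*k+1)) \<ge> (1 - r j) * dist (x (2*j)) (x (2*j+1)) + (1 - r k) * dist (x (2*k)) (x (2*k+1))))"

end

theory Submission
  imports Defs
begin

text \<open>If Y is finite-dimensional, bounded sequences in Y have convergent subsequences, so a
  maximizing sequence of difference quotients of f has a subsequence converging to a vector of
  norm ||f||.

  If Y is infinite-dimensional, Riesz's lemma yields unit vectors e_n at distance at least 1/2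
  from the span of e_0, ..., e_(n-1). Each pair of the pairly distanced sequence carries a
  1-Lipschitz tent function h_j, and tents of different pairs are so far apart that
  f = \<Sum>_j a_j h_j e_j, with weights a_j < 1 increasing to 1, has norm 1 and every difference
  quotient of f has the form \<alpha> e_j + \<beta> e_k with j < k, |\<alpha>| \<le> a_j and
  |\<alpha>| + |\<beta>| \<le> a_k. If such quotients converged to a vector of norm 1, both indices would
  have to tend to infinity, and then the separation of the e_n forces first \<beta> and then \<alpha>
  to tend to 0.\<close>

lemma ex_finite_dimensional_vector_space_iff_finite_span:
  "(\<exists>B. finite_dimensional_vector_space ((*\<^sub>R) :: real \<Rightarrow> 'b \<Rightarrow> 'b::real_vector) B)
   \<longleftrightarrow> (\<exists>S. finite S \<and> span S = (UNIV :: 'b set))"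
proof
  assume "\<exists>B. finite_dimensional_vector_space ((*\<^sub>R) :: real \<Rightarrow> 'b \<Rightarrow> 'b) B"
  then show "\<exists>S. finite S \<and> span S = (UNIV :: 'b set)"
    unfolding finite_dimensional_vector_space_def finite_dimensional_vector_space_axioms_def span_raw_def
    by blast
next
  assume "\<exists>S. finite S \<and> span S = (UNIV :: 'b set)"
  then obtain S :: "'b set" where S: "finite S" "span S = UNIV" by blast
  obtain B where B: "B \<subseteq> S" "independent B" "S \<subseteq> span B"
    using maximal_independent_subset by blast
  have "finite B" using B(1) S(1) finite_subset by blast
  moreover have "span B = UNIV" using B(3) S(2) span_minimal subspace_span by blast
  ultimately show "\<exists>B. finite_dimensional_vector_space ((*\<^sub>R) :: real \<Rightarrow> 'b \<Rightarrow> 'b) B"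
    using B(2) real_vector.vector_space_axioms
    unfolding finite_dimensional_vector_space_def finite_dimensional_vector_space_axioms_def
      span_raw_def dependent_raw_def
    by blast
qed

lemma closed_if_bounded_sequences_subconverge:
  fixes A :: "'a::metric_space set"
  assumes "\<And>X :: nat \<Rightarrow> 'a. (\<And>n. X n \<in> A) \<Longrightarrow> bounded (range X) \<Longrightarrow>
             \<exists>r l. strict_mono r \<and> l \<in> A \<and> (X \<circ> r) \<longlonglongrightarrow> l"
  shows "closed A"
proof (rule closed_sequential_limits[THEN iffD2], intro allI impI, elim conjE)
  fix X l assume X: "\<forall>n. X n \<in> A" and lim: "X \<longlonglongrightarrow> l"
  obtain r l' where r: "strict_mono r" "l' \<in> A" "(X \<circ> r) \<longlonglongrightarrow> l'"
    using assms[of X] X convergent_imp_bounded[OF lim] by blast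
  have "(X \<circ> r) \<longlonglongrightarrow> l" using LIMSEQ_subseq_LIMSEQ[OF lim r(1)] .
  with r show "l \<in> A" using LIMSEQ_unique by blast
qed

lemma abs_scale_infdist_span_le:
  fixes v :: "'b::real_normed_vector"
  assumes "t \<in> span T"
  shows "\<bar>c\<bar> * infdist v (span T) \<le> norm (t + c *\<^sub>R v)"
proof (cases "c = 0")
  case False
  have "(- (1/c)) *\<^sub>R t \<in> span T" using assms span_scale by blast
  then have "infdist v (span T) \<le> norm (v + (1/c) *\<^sub>R t)"
    using infdist_le by (fastforce simp: dist_norm)
  then have "\<bar>c\<bar> * infdist v (span T) \<le> norm (c *\<^sub>R (v + (1/c) *\<^sub>R t))"
    by (simp add: mult_left_mono)
  also have "c *\<^sub>R (v + (1/c) *\<^sub>R t) = t + c *\<^sub>R v"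
    using False by (simp add: algebra_simps)
  finally show ?thesis .
qed simp

lemma span_insert_decomposition_bounded:
  fixes v :: "'b::real_normed_vector" and X :: "nat \<Rightarrow> 'b"
  assumes "closed (span T)" "v \<notin> span T"
    and "\<And>n. X n \<in> span (insert v T)" "bounded (range X)"
  obtains c where "bounded (range c)" "\<And>n. X n - c n *\<^sub>R v \<in> span T"
    "bounded (range (\<lambda>n. X n - c n *\<^sub>R v))"
proof -
  define d where "d = infdist v (span T)"
  have d: "d > 0" unfolding d_def using infdist_pos_not_in_closed assms(1,2) span_zero by blast
  have "\<forall>n. \<exists>k. X n - k *\<^sub>R v \<in> span T"
    using assms(3) by (simp add: span_insert)
  then obtain c where c: "\<And>n. X n - c n *\<^sub>R v \<in> span T" by metis
  obtain B where B: "\<And>n. norm (X n) \<le> B"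
    using assms(4) unfolding bounded_iff by auto
  have c_bound: "\<bar>c n\<bar> \<le> B / d" for n
    using abs_scale_infdist_span_le[OF c[of n], of "c n" v] B[of n] d
    by (simp add: d_def pos_le_divide_eq)
  have "norm (X n - c n *\<^sub>R v) \<le> B + B / d * norm v" for n
  proof -
    have "norm (X n - c n *\<^sub>R v) \<le> norm (X n) + \<bar>c n\<bar> * norm v"
      using norm_triangle_ineq4[of "X n" "c n *\<^sub>R v"] by simp
    also have "\<dots> \<le> B + B / d * norm v"
      using B[of n] c_bound[of n] by (intro add_mono mult_right_mono) auto
    finally show ?thesis .
  qed
  with c c_bound show thesis by (intro that[of c]) (auto simp: bounded_iff)
qed

text \<open>Bolzano--Weierstrass in a finite-dimensional subspace, by induction on a spanning set:
  a new vector outside the (closed) previous span has coefficient controlled by its distance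
  to that span.\<close>
lemma finite_span_bounded_subseq_converges:
  fixes S :: "'b::real_normed_vector set" and X :: "nat \<Rightarrow> 'b"
  assumes "finite S" "\<And>n. X n \<in> span S" "bounded (range X)"
  shows "\<exists>r l. strict_mono r \<and> l \<in> span S \<and> (X \<circ> r) \<longlonglongrightarrow> l"
  using assms
proof (induction S arbitrary: X rule: finite_induct)
  case empty
  then have "X = (\<lambda>n. 0)" by (simp add: fun_eq_iff)
  then have "(X \<circ> id) \<longlonglongrightarrow> 0" by simp
  then show ?case using strict_mono_id span_zero by blast
next
  case (insert v T)
  show ?case
  proof (cases "v \<in> span T")
    case True
    then show ?thesis using insert by (simp add: span_redundant)
  next
    case False
    have closed: "closed (span T)"
      by (rule closed_if_bounded_sequences_subconverge, rule insert.IH)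
    obtain c where c: "bounded (range c)" "\<And>n. X n - c n *\<^sub>R v \<in> span T"
      "bounded (range (\<lambda>n. X n - c n *\<^sub>R v))"
      using span_insert_decomposition_bounded[OF closed False insert.prems] by blast
    define t where "t n = X n - c n *\<^sub>R v" for n
    obtain r1 c0 where r1: "strict_mono r1" "(c \<circ> r1) \<longlonglongrightarrow> c0"
      using bounded_imp_convergent_subsequence[OF c(1)] by blast
    have "bounded (range (t \<circ> r1))"
      using c(3) by (rule bounded_subset) (auto simp: t_def)
    moreover have "(t \<circ> r1) n \<in> span T" for n using c(2) by (simp add: t_def)
    ultimately obtain r2 t0 where r2: "strict_mono r2" "t0 \<in> span T" "(t \<circ> r1 \<circ> r2) \<longlonglongrightarrow> t0"
      using insert.IH[of "t \<circ> r1"] by blast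
    have "(c \<circ> r1 \<circ> r2) \<longlonglongrightarrow> c0" using LIMSEQ_subseq_LIMSEQ[OF r1(2) r2(1)] .
    with r2(3) have "(\<lambda>n. t (r1 (r2 n)) + c (r1 (r2 n)) *\<^sub>R v) \<longlonglongrightarrow> t0 + c0 *\<^sub>R v"
      by (auto intro!: tendsto_intros simp: o_def)
    then have "(X \<circ> (r1 \<circ> r2)) \<longlonglongrightarrow> t0 + c0 *\<^sub>R v" by (simp add: t_def o_def)
    moreover have "t0 + c0 *\<^sub>R v \<in> span (insert v T)"
      using r2(2) by (meson span_add span_base span_mono span_scale insertI1 subset_insertI subsetD)
    ultimately show ?thesis using strict_mono_o[OF r1(1) r2(1)] by blast
  qed
qed

lemma closed_span_finite:
  fixes S :: "'b::real_normed_vector set"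
  assumes "finite S"
  shows "closed (span S)"
  using finite_span_bounded_subseq_converges[OF assms]
  by (intro closed_if_bounded_sequences_subconverge) blast

lemma riesz_lemma:
  fixes S :: "'b::real_normed_vector set"
  assumes "finite S" "span S \<noteq> UNIV"
  shows "\<exists>e. norm e = 1 \<and> (\<forall>w\<in>span S. 1/2 \<le> norm (e - w))"
proof -
  obtain z where z: "z \<notin> span S" using assms(2) by blast
  define d where "d = infdist z (span S)"
  have ne: "span S \<noteq> {}" using span_zero by blast
  have d: "d > 0" unfolding d_def
    using infdist_pos_not_in_closed[OF closed_span_finite[OF assms(1)] ne z] .
  then have "(INF a\<in>span S. dist z a) < 2 * d"
    by (simp add: d_def infdist_notempty[OF ne])
  then obtain s where s: "s \<in> span S" "dist z s < 2 * d"
    by (subst (asm) cINF_less_iff) (use ne in \<open>auto intro: bdd_belowI[of _ 0]\<close>)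
  define c where "c = norm (z - s)"
  have c: "0 < c" "c < 2 * d" using s z by (auto simp: c_def dist_norm)
  show ?thesis
  proof (intro exI conjI ballI)
    show "norm ((1/c) *\<^sub>R (z - s)) = 1" using c by (simp add: c_def)
    fix w assume "w \<in> span S"
    then have "s + c *\<^sub>R w \<in> span S" using s(1) by (simp add: span_add span_scale)
    then have "d \<le> norm (c *\<^sub>R ((1/c) *\<^sub>R (z - s) - w))"
      unfolding d_def using infdist_le c(1) by (fastforce simp: dist_norm algebra_simps)
    then have "d / c \<le> norm ((1/c) *\<^sub>R (z - s) - w)"
      using c(1) by (simp add: divide_le_eq mult.commute)
    moreover have "1/2 \<le> d / c" using c by (simp add: field_simps)
    ultimately show "1/2 \<le> norm ((1/c) *\<^sub>R (z - s) - w)" by linarith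
  qed
qed

definition riesz_sequence :: "(nat \<Rightarrow> 'b::real_normed_vector) \<Rightarrow> bool" where
  "riesz_sequence e \<longleftrightarrow> (\<forall>n. norm (e n) = 1 \<and> (\<forall>w\<in>span (e ` {..<n}). 1/2 \<le> norm (e n - w)))"

lemma riesz_sequence_exists:
  assumes "\<not> (\<exists>S. finite S \<and> span S = (UNIV :: 'b::real_normed_vector set))"
  shows "\<exists>e :: nat \<Rightarrow> 'b. riesz_sequence e"
proof -
  define pick where "pick A = (SOME e. norm e = 1 \<and> (\<forall>w\<in>span A. 1/2 \<le> norm (e - w)))"
    for A :: "'b set"
  have pick: "norm (pick A) = 1 \<and> (\<forall>w\<in>span A. 1/2 \<le> norm (pick A - w))" if "finite A" for A
  proof -
    have "span A \<noteq> UNIV" using assms that by blast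
    from riesz_lemma[OF that this] show ?thesis unfolding pick_def by (rule someI_ex)
  qed
  define E where "E = rec_nat {} (\<lambda>n A. insert (pick A) A)"
  define e where "e n = pick (E n)" for n
  have E: "E n = e ` {..<n}" for n
    by (induction n) (auto simp: E_def e_def lessThan_Suc)
  have "norm (e n) = 1 \<and> (\<forall>w\<in>span (e ` {..<n}). 1/2 \<le> norm (e n - w))" for n
  proof -
    have "finite (E n)" by (simp add: E)
    from pick[OF this] show ?thesis unfolding E[symmetric] e_def by simp
  qed
  then show ?thesis unfolding riesz_sequence_def by blast
qed

lemma riesz_sequence_norm:
  "riesz_sequence e \<Longrightarrow> norm (e n) = 1"
  by (simp add: riesz_sequence_def)

lemma riesz_sequence_coeff_le:
  assumes "riesz_sequence e" "w \<in> span (e ` {..<k})"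
  shows "\<bar>c\<bar> / 2 \<le> norm (c *\<^sub>R e k - w)"
proof (cases "c = 0")
  case False
  have "(1/c) *\<^sub>R w \<in> span (e ` {..<k})" using assms(2) span_scale by blast
  then have "1/2 \<le> norm (e k - (1/c) *\<^sub>R w)" using assms(1) by (simp add: riesz_sequence_def)
  then have "\<bar>c\<bar> * (1/2) \<le> \<bar>c\<bar> * norm (e k - (1/c) *\<^sub>R w)" by (rule mult_left_mono) simp
  also have "\<dots> = norm (c *\<^sub>R (e k - (1/c) *\<^sub>R w))" by simp
  also have "c *\<^sub>R (e k - (1/c) *\<^sub>R w) = c *\<^sub>R e k - w" using False by (simp add: algebra_simps)
  finally show ?thesis by simp
qed simp

text \<open>In a convergent sequence, the coefficient of a Riesz vector whose index tends to infinity
  must vanish: the difference of two late terms is at least half that coefficient.\<close>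
lemma riesz_sequence_coeff_tendsto_zero:
  assumes e: "riesz_sequence e" and Q: "Q \<longlonglongrightarrow> y"
    and m: "filterlim m at_top sequentially"
    and rest: "\<And>n. Q n - \<gamma> n *\<^sub>R e (m n) \<in> span (e ` {..<m n})"
  shows "\<gamma> \<longlonglongrightarrow> 0"
proof (rule LIMSEQ_I)
  fix \<epsilon> :: real assume "0 < \<epsilon>"
  then obtain N where N: "\<And>n. N \<le> n \<Longrightarrow> norm (Q n - y) < \<epsilon> / 4"
    using LIMSEQ_D[OF Q, of "\<epsilon> / 4"] by auto
  obtain N' where N': "\<And>n. N' \<le> n \<Longrightarrow> Suc (m N) \<le> m n"
    using m unfolding filterlim_at_top eventually_sequentially by blast
  show "\<exists>N. \<forall>n\<ge>N. norm (\<gamma> n - 0) < \<epsilon>"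
  proof (intro exI allI impI)
    fix n assume n: "max N N' \<le> n"
    have "{..<m N} \<subseteq> {..<m n}" "m N \<in> {..<m n}" using N'[of n] n by auto
    then have "Q N - \<gamma> N *\<^sub>R e (m N) \<in> span (e ` {..<m n})" "\<gamma> N *\<^sub>R e (m N) \<in> span (e ` {..<m n})"
      using rest[of N] span_mono[OF image_mono] by (blast, simp add: span_base span_scale)
    from span_add[OF this] have "Q N \<in> span (e ` {..<m n})" by simp
    then have "Q N - (Q n - \<gamma> n *\<^sub>R e (m n)) \<in> span (e ` {..<m n})"
      using rest[of n] by (rule span_diff)
    from riesz_sequence_coeff_le[OF e this]
    have "\<bar>\<gamma> n\<bar> / 2 \<le> norm (\<gamma> n *\<^sub>R e (m n) - (Q N - (Q n - \<gamma> n *\<^sub>R e (m n))))" .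
    also have "\<dots> = norm ((Q n - y) - (Q N - y))" by (simp add: algebra_simps)
    also have "\<dots> \<le> norm (Q n - y) + norm (Q N - y)" by (rule norm_triangle_ineq4)
    also have "\<dots> < \<epsilon> / 2" using N[of n] N[of N] n by simp
    finally show "norm (\<gamma> n - 0) < \<epsilon>" by simp
  qed
qed

lemma lipschitz_on_quotient_le:
  assumes "C-lipschitz_on UNIV f" "p \<noteq> q"
  shows "norm (f p - f q) / dist p q \<le> C"
  using lipschitz_onD[OF assms(1)] assms(2) by (simp add: dist_norm divide_le_eq)

lemma lip_norm_maximizing_pairs:
  fixes f :: "'a::metric_space \<Rightarrow> 'b::real_normed_vector" and p0 q0 :: 'a
  assumes "C-lipschitz_on UNIV f" "p0 \<noteq> q0"
  obtains p q :: "nat \<Rightarrow> 'a" where "\<And>n. p n \<noteq> q n"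
    "(\<lambda>n. norm (f (p n) - f (q n)) / dist (p n) (q n)) \<longlonglongrightarrow> lip_norm f"
proof -
  define D where "D = {norm (f p - f q) / dist p q | p q. p \<noteq> q}"
  have "norm (f p0 - f q0) / dist p0 q0 \<in> D" unfolding D_def using assms(2) by blast
  then have "D \<noteq> {}" by blast
  moreover have "bdd_above D"
    unfolding D_def using lipschitz_on_quotient_le[OF assms(1)] by (intro bdd_aboveI[of _ C]) auto
  ultimately have "lip_norm f \<in> closure D"
    unfolding lip_norm_def D_def[symmetric] by (rule closure_contains_Sup)
  then obtain s where s: "\<And>n. s n \<in> D" "s \<longlonglongrightarrow> lip_norm f"
    unfolding closure_sequential by blast
  have "\<forall>n. \<exists>p q. p \<noteq> q \<and> s n = norm (f p - f q) / dist p q"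
    using s(1) unfolding D_def by blast
  then obtain p q where pq: "\<And>n. p n \<noteq> q n"
    and "\<And>n. s n = norm (f (p n) - f (q n)) / dist (p n) (q n)"
    by metis
  then have "s = (\<lambda>n. norm (f (p n) - f (q n)) / dist (p n) (q n))" by blast
  with pq s(2) show thesis by (intro that) simp_all
qed

lemma finite_span_attains_norm_toward:
  fixes f :: "'a::metric_space \<Rightarrow> 'b::real_normed_vector" and S :: "'b set" and p0 q0 :: 'a
  assumes "finite S" "span S = UNIV" "C-lipschitz_on UNIV f" "p0 \<noteq> q0"
  shows "\<exists>y. attains_norm_toward f y"
proof -
  obtain p q where pq: "\<And>n. p n \<noteq> q n"
    and max: "(\<lambda>n. norm (f (p n) - f (q n)) / dist (p n) (q n)) \<longlonglongrightarrow> lip_norm f"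
    using lip_norm_maximizing_pairs[OF assms(3,4)] by blast
  define Q where "Q n = (1 / dist (p n) (q n)) *\<^sub>R (f (p n) - f (q n))" for n
  have norm_Q: "norm (Q n) = norm (f (p n) - f (q n)) / dist (p n) (q n)" for n
    by (simp add: Q_def)
  then have "bounded (range Q)"
    using lipschitz_on_quotient_le[OF assms(3) pq] unfolding bounded_iff by auto
  then obtain r y where r: "strict_mono r" "(Q \<circ> r) \<longlonglongrightarrow> y"
    using finite_span_bounded_subseq_converges[OF assms(1)] assms(2) by blast
  have "(\<lambda>n. norm (Q (r n))) \<longlonglongrightarrow> norm y" using tendsto_norm[OF r(2)] by (simp add: o_def)
  moreover have "(\<lambda>n. norm (Q (r n))) \<longlonglongrightarrow> lip_norm f"
    using LIMSEQ_subseq_LIMSEQ[OF max r(1)] by (simp add: norm_Q o_def)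
  ultimately have "norm y = lip_norm f" by (rule LIMSEQ_unique)
  then have "attains_norm_toward f y"
    unfolding attains_norm_toward_def using pq r(2)
    by (intro exI[of _ "p \<circ> r"] exI[of _ "q \<circ> r"]) (simp add: Q_def o_def)
  then show ?thesis ..
qed

definition weight :: "nat \<Rightarrow> real" where
  "weight j = real (Suc j) / real (Suc (Suc j))"

lemma weight_nonneg: "0 \<le> weight j"
  by (simp add: weight_def)

lemma weight_less_one: "weight j < 1"
  by (simp add: weight_def)

lemma incseq_weight: "incseq weight"
  by (rule incseq_SucI) (simp add: weight_def field_simps)

lemma weight_tendsto_one: "weight \<longlonglongrightarrow> 1"
  unfolding weight_def using LIMSEQ_Suc[OF LIMSEQ_n_over_Suc_n] by simp

definition weighted_pair_combination ::
    "(nat \<Rightarrow> real) \<Rightarrow> (nat \<Rightarrow> 'b::real_vector) \<Rightarrow> 'b \<Rightarrow> bool" where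
  "weighted_pair_combination a e v \<longleftrightarrow>
     (\<exists>j k \<alpha> \<beta>. j < k \<and> v = \<alpha> *\<^sub>R e j + \<beta> *\<^sub>R e k \<and> \<bar>\<alpha>\<bar> \<le> a j \<and> \<bar>\<alpha>\<bar> + \<bar>\<beta>\<bar> \<le> a k)"

lemma weighted_pair_combination_single:
  assumes "incseq a" "0 \<le> a j" "\<bar>s\<bar> \<le> 1"
  shows "weighted_pair_combination a e ((a j * s) *\<^sub>R e j)"
proof -
  have "\<bar>a j * s\<bar> \<le> a j"
    using assms(2,3) mult_left_mono[OF assms(3) assms(2)] by (simp add: abs_mult)
  moreover have "a j \<le> a (Suc j)" using assms(1) by (simp add: incseq_SucD)
  ultimately show ?thesis unfolding weighted_pair_combination_def
    by (intro exI[of _ j] exI[of _ "Suc j"] exI[of _ "a j * s"] exI[of _ 0]) simp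
qed

lemma weighted_pair_combination_pair:
  assumes "incseq a" "\<And>j. 0 \<le> a j" "j \<noteq> k" "\<bar>s\<bar> + \<bar>t\<bar> \<le> 1"
  shows "weighted_pair_combination a e ((a j * s) *\<^sub>R e j + (a k * t) *\<^sub>R e k)"
  using assms(3,4)
proof (induction j k arbitrary: s t rule: linorder_wlog)
  case (le j k)
  then have "j < k" by simp
  have "\<bar>a j * s\<bar> + \<bar>a k * t\<bar> \<le> a k * \<bar>s\<bar> + a k * \<bar>t\<bar>"
    using assms(1,2) \<open>j < k\<close> by (intro add_mono) (auto simp: abs_mult incseq_def mult_right_mono)
  also have "\<dots> \<le> a k" using mult_left_mono[OF le.prems(2) assms(2)] by (simp add: algebra_simps)
  finally have "\<bar>a j * s\<bar> + \<bar>a k * t\<bar> \<le> a k" .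
  moreover have "\<bar>a j * s\<bar> \<le> a j"
    using mult_left_mono[of "\<bar>s\<bar>" 1 "a j"] le.prems(2) assms(2) by (simp add: abs_mult)
  ultimately show ?case unfolding weighted_pair_combination_def using \<open>j < k\<close> by blast
next
  case (sym j k)
  then have "k \<noteq> j" "\<bar>t\<bar> + \<bar>s\<bar> \<le> 1" by auto
  from sym.IH[OF this] show ?case by (simp add: add.commute)
qed

lemma weighted_pair_combination_norm_le:
  assumes "weighted_pair_combination a e v" "\<And>j. norm (e j) = 1" "\<And>j. a j \<le> 1"
  shows "norm v \<le> 1"
proof -
  obtain j k \<alpha> \<beta> where v: "v = \<alpha> *\<^sub>R e j + \<beta> *\<^sub>R e k" "\<bar>\<alpha>\<bar> + \<bar>\<beta>\<bar> \<le> a k"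
    using assms(1) unfolding weighted_pair_combination_def by blast
  have "norm v \<le> \<bar>\<alpha>\<bar> + \<bar>\<beta>\<bar>"
    using norm_triangle_ineq[of "\<alpha> *\<^sub>R e j" "\<beta> *\<^sub>R e k"] by (simp add: v(1) assms(2))
  with v(2) assms(3)[of k] show ?thesis by linarith
qed

lemma index_tendsto_at_top_if_weighted_norms_tendsto_one:
  fixes a :: "nat \<Rightarrow> real"
  assumes "incseq a" "\<And>j. a j < 1" "t \<longlonglongrightarrow> 1" "\<And>n. t n \<le> a (k n)"
  shows "filterlim k at_top sequentially"
  unfolding filterlim_at_top
proof
  fix K
  have "\<forall>\<^sub>F n in sequentially. a K < t n" using order_tendstoD(1)[OF assms(3) assms(2)] .
  then show "\<forall>\<^sub>F n in sequentially. K \<le> k n"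
  proof (rule eventually_mono)
    fix n assume "a K < t n"
    with assms(4)[of n] have "a K < a (k n)" by linarith
    then show "K \<le> k n" using assms(1) by (metis incseq_def linorder_not_le order.strict_iff_not)
  qed
qed

lemma weighted_pair_combination_limit_norm_neq_one:
  assumes e: "riesz_sequence e" and a: "incseq a" "\<And>j. a j < 1"
    and Q: "\<And>n. weighted_pair_combination a e (Q n)" "Q \<longlonglongrightarrow> y"
  shows "norm y \<noteq> 1"
proof
  assume y: "norm y = 1"
  obtain J K A B where JK: "\<And>n. J n < K n"
    and Q_eq: "\<And>n. Q n = A n *\<^sub>R e (J n) + B n *\<^sub>R e (K n)"
    and A: "\<And>n. \<bar>A n\<bar> \<le> a (J n)" and AB: "\<And>n. \<bar>A n\<bar> + \<bar>B n\<bar> \<le> a (K n)"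
    using Q(1) unfolding weighted_pair_combination_def by metis
  have e1: "norm (e j) = 1" for j using e by (rule riesz_sequence_norm)
  define R where "R n = A n *\<^sub>R e (J n)" for n
  have norm_Q_le: "norm (Q n) \<le> a (K n)" for n
    using norm_triangle_ineq[of "A n *\<^sub>R e (J n)" "B n *\<^sub>R e (K n)"] AB[of n] by (simp add: Q_eq e1)
  have "(\<lambda>n. norm (Q n)) \<longlonglongrightarrow> 1" using tendsto_norm[OF Q(2)] y by simp
  from index_tendsto_at_top_if_weighted_norms_tendsto_one[OF a this norm_Q_le]
  have "filterlim K at_top sequentially" .
  moreover have "Q n - B n *\<^sub>R e (K n) \<in> span (e ` {..<K n})" for n
    using JK[of n] by (simp add: Q_eq span_base span_scale)
  ultimately have "B \<longlonglongrightarrow> 0" by (rule riesz_sequence_coeff_tendsto_zero[OF e Q(2)])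
  then have "(\<lambda>n. norm (B n *\<^sub>R e (K n))) \<longlonglongrightarrow> 0"
    using tendsto_rabs_zero by (simp add: e1)
  from tendsto_diff[OF Q(2) tendsto_norm_zero_cancel[OF this]] have R: "R \<longlonglongrightarrow> y"
    by (simp add: R_def[abs_def] Q_eq)
  have norm_R: "norm (R n) = \<bar>A n\<bar>" for n by (simp add: R_def e1)
  have abs_A: "(\<lambda>n. \<bar>A n\<bar>) \<longlonglongrightarrow> 1" using tendsto_norm[OF R] y by (simp add: norm_R)
  from index_tendsto_at_top_if_weighted_norms_tendsto_one[OF a this A]
  have "filterlim J at_top sequentially" .
  moreover have "R n - A n *\<^sub>R e (J n) \<in> span (e ` {..<J n})" for n by (simp add: R_def span_zero)
  ultimately have "A \<longlonglongrightarrow> 0" by (rule riesz_sequence_coeff_tendsto_zero[OF e R])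
  from LIMSEQ_unique[OF abs_A tendsto_rabs_zero[OF this]] show False by simp
qed

lemma lip_norm_diff_const: "lip_norm (\<lambda>p. f p - c) = lip_norm f"
  by (simp add: lip_norm_def)

lemma attains_norm_toward_diff_const:
  "attains_norm_toward (\<lambda>p. f p - c) y \<longleftrightarrow> attains_norm_toward f y"
  by (simp add: attains_norm_toward_def lip_norm_diff_const)

lemma lip_norm_eqI:
  fixes f :: "'a::metric_space \<Rightarrow> 'b::real_normed_vector"
  assumes le: "\<And>p q. p \<noteq> q \<Longrightarrow> norm (f p - f q) / dist p q \<le> L"
    and pq: "\<And>n. p n \<noteq> q n"
    and lim: "(\<lambda>n. norm (f (p n) - f (q n)) / dist (p n) (q n)) \<longlonglongrightarrow> L"
  shows "lip_norm f = L"
proof -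
  define D where "D = {norm (f p - f q) / dist p q | p q. p \<noteq> q}"
  have in_D: "norm (f (p n) - f (q n)) / dist (p n) (q n) \<in> D" for n
    unfolding D_def using pq by blast
  have bdd: "bdd_above D" unfolding D_def using le by (intro bdd_aboveI[of _ L]) auto
  have "D \<noteq> {}" using in_D by blast
  then have "Sup D \<le> L" by (rule cSup_least) (auto simp: D_def intro: le)
  moreover have "L \<le> Sup D"
    using in_D bdd by (intro LIMSEQ_le_const2[OF lim]) (auto intro: cSup_upper)
  ultimately show ?thesis unfolding lip_norm_def D_def[symmetric] by simp
qed

locale disjoint_bumps =
  fixes h :: "nat \<Rightarrow> 'a::metric_space \<Rightarrow> real"
  assumes bump_lipschitz: "\<bar>h j p - h j q\<bar> \<le> dist p q"
    and bumps_apart: "j \<noteq> k \<Longrightarrow> h j p \<noteq> 0 \<Longrightarrow> h k q \<noteq> 0 \<Longrightarrow> \<bar>h j p\<bar> + \<bar>h k q\<bar> \<le> dist p q"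
begin

text \<open>If all bumps vanish at p, then active p is arbitrary, but bump_map below is 0 there anyway.\<close>
definition active :: "'a \<Rightarrow> nat" where
  "active p = (SOME j. h j p \<noteq> 0)"

lemma bump_eq_0_if_not_active:
  assumes "k \<noteq> active p"
  shows "h k p = 0"
proof (rule ccontr)
  assume "h k p \<noteq> 0"
  then have "h (active p) p \<noteq> 0" unfolding active_def by (rule someI)
  with \<open>h k p \<noteq> 0\<close> assms show False using bumps_apart[of k "active p" p p] by simp
qed

definition bump_map :: "(nat \<Rightarrow> real) \<Rightarrow> (nat \<Rightarrow> 'b::real_normed_vector) \<Rightarrow> 'a \<Rightarrow> 'b" where
  "bump_map a e p = (a (active p) * h (active p) p) *\<^sub>R e (active p)"

lemma bump_map_eq:
  assumes "\<And>k. k \<noteq> j \<Longrightarrow> h k p = 0"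
  shows "bump_map a e p = (a j * h j p) *\<^sub>R e j"
proof (cases "active p = j")
  case False
  then show ?thesis
    using assms[OF False] bump_eq_0_if_not_active[of j p] by (simp add: bump_map_def)
qed (simp add: bump_map_def)

lemma bump_map_quotient:
  assumes "incseq a" "\<And>j. 0 \<le> a j" "p \<noteq> q"
  shows "weighted_pair_combination a e ((1 / dist p q) *\<^sub>R (bump_map a e p - bump_map a e q))"
proof -
  define D where "D = dist p q"
  have D: "D > 0" using assms(3) by (simp add: D_def)
  define j where "j = active p"
  define k where "k = active q"
  have quotient: "(1 / D) *\<^sub>R (bump_map a e p - bump_map a e q)
      = (a j * (h j p / D)) *\<^sub>R e j + (a k * (- h k q / D)) *\<^sub>R e k"
    by (simp add: bump_map_def j_def k_def algebra_simps)
  show ?thesis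
  proof (cases "j = k")
    case True
    have "\<bar>(h j p - h j q) / D\<bar> \<le> 1" using bump_lipschitz[of j p q] D by (simp add: D_def)
    then have "weighted_pair_combination a e ((a j * ((h j p - h j q) / D)) *\<^sub>R e j)"
      using assms(1,2) by (rule weighted_pair_combination_single[rotated 2])
    moreover have "(a j * ((h j p - h j q) / D)) *\<^sub>R e j
        = (a j * (h j p / D)) *\<^sub>R e j + (a k * (- h k q / D)) *\<^sub>R e k"
      using True by (simp add: algebra_simps diff_divide_distrib)
    ultimately show ?thesis using quotient by (simp add: D_def)
  next
    case False
    have "\<bar>h j p\<bar> + \<bar>h k q\<bar> \<le> D"
    proof (cases "h j p = 0 \<or> h k q = 0")
      case True
      have "h k p = 0" "h j q = 0"
        using False bump_eq_0_if_not_active by (auto simp: j_def k_def)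
      with True show ?thesis
        using bump_lipschitz[of k p q] bump_lipschitz[of j p q] by (auto simp: D_def)
    next
      case nonzero: False
      from bumps_apart[OF \<open>j \<noteq> k\<close>] nonzero show ?thesis by (simp add: D_def)
    qed
    then have "\<bar>h j p / D\<bar> + \<bar>- h k q / D\<bar> \<le> 1"
      using D by (simp add: add_divide_distrib[symmetric])
    from weighted_pair_combination_pair[OF assms(1,2) False this]
    show ?thesis using quotient by (simp add: D_def)
  qed
qed

lemma bump_map_lipschitz:
  assumes "incseq a" "\<And>j. 0 \<le> a j" "\<And>j. a j \<le> 1" "\<And>j. norm (e j) = 1"
  shows "1-lipschitz_on UNIV (bump_map a e)"
proof (rule lipschitz_onI)
  fix p q :: 'a
  show "dist (bump_map a e p) (bump_map a e q) \<le> 1 * dist p q"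
  proof (cases "p = q")
    case False
    from weighted_pair_combination_norm_le[OF bump_map_quotient[OF assms(1,2) False] assms(4,3)]
    show ?thesis using False by (simp add: dist_norm divide_le_eq)
  qed simp
qed simp

end

locale pairly_distanced_seq =
  fixes x :: "nat \<Rightarrow> 'a::metric_space" and r :: "nat \<Rightarrow> real"
  assumes inj_x: "inj x" and r_nonneg: "0 \<le> r j" and r_le_one: "r j \<le> 1"
    and pairs_apart: "j \<noteq> k \<Longrightarrow>
          dist (x (2*j)) (x (2*k)) \<ge> r j * dist (x (2*j)) (x (2*j+1)) + r k * dist (x (2*k)) (x (2*k+1)) \<and>
          dist (x (2*j)) (x (2*k+1)) \<ge> r j * dist (x (2*j)) (x (2*j+1)) + (1 - r k) * dist (x (2*k)) (x (2*k+1)) \<and>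
          dist (x (2*j+1)) (x (2*k+1)) \<ge> (1 - r j) * dist (x (2*j)) (x (2*j+1)) + (1 - r k) * dist (x (2*k)) (x (2*k+1))"

lemma pairly_distancedE:
  assumes "pairly_distanced x"
  obtains r where "pairly_distanced_seq x r"
  using assms unfolding pairly_distanced_def pairly_distanced_seq_def by blast

context pairly_distanced_seq
begin

definition pair_dist :: "nat \<Rightarrow> real" where
  "pair_dist j = dist (x (2*j)) (x (2*j+1))"

definition left_radius :: "nat \<Rightarrow> real" where
  "left_radius j = r j * pair_dist j"

definition right_radius :: "nat \<Rightarrow> real" where
  "right_radius j = (1 - r j) * pair_dist j"

text \<open>The pairly distanced condition says precisely that the supporting balls of tents of
  different pairs do not overlap: their centres are at least the sum of their radii apart.\<close>
definition tent :: "nat \<Rightarrow> 'a \<Rightarrow> real" where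
  "tent j p = max 0 (left_radius j - dist p (x (2*j))) - max 0 (right_radius j - dist p (x (2*j+1)))"

lemma pair_dist_pos: "0 < pair_dist j"
proof -
  have "x (2*j) \<noteq> x (2*j+1)" using inj_x by (metis inj_eq n_not_Suc_n Suc_eq_plus1)
  then show ?thesis by (simp add: pair_dist_def)
qed

lemma radii_nonneg: "0 \<le> left_radius j" "0 \<le> right_radius j"
  using r_nonneg[of j] r_le_one[of j] pair_dist_pos[of j]
  by (simp_all add: left_radius_def right_radius_def)

lemma radii_sum: "left_radius j + right_radius j = pair_dist j"
  by (simp add: left_radius_def right_radius_def algebra_simps)

lemma radii_apart:
  assumes "j \<noteq> k"
  shows "left_radius j + left_radius k \<le> dist (x (2*j)) (x (2*k))"
    and "left_radius j + right_radius k \<le> dist (x (2*j)) (x (2*k+1))"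
    and "right_radius j + right_radius k \<le> dist (x (2*j+1)) (x (2*k+1))"
  using pairs_apart[OF assms]
  by (simp_all add: left_radius_def right_radius_def pair_dist_def)

lemma tent_lipschitz: "\<bar>tent j p - tent j q\<bar> \<le> dist p q"
proof -
  define u v where "u = x (2*j)" and "v = x (2*j+1)"
  have "dist u v \<le> dist u p + dist p v" "dist p u \<le> dist p q + dist q u"
    "dist q u \<le> dist q p + dist p u" "dist p v \<le> dist p q + dist q v"
    "dist q v \<le> dist q p + dist p v" "dist u v \<le> dist u q + dist q v"
    by (rule dist_triangle)+
  moreover have "left_radius j + right_radius j = dist u v"
    by (simp add: radii_sum u_def v_def pair_dist_def)
  ultimately show ?thesis
    using radii_nonneg[of j] unfolding tent_def u_def[symmetric] v_def[symmetric] max_def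
    by (smt (verit) dist_commute)
qed

lemma tents_apart:
  assumes "j \<noteq> k" "tent j p \<noteq> 0" "tent k q \<noteq> 0"
  shows "\<bar>tent j p\<bar> + \<bar>tent k q\<bar> \<le> dist p q"
proof -
  define u1 v1 u2 v2 where "u1 = x (2*j)" and "v1 = x (2*j+1)" and "u2 = x (2*k)" and "v2 = x (2*k+1)"
  have "dist u1 u2 \<le> dist u1 p + dist p u2" "dist p u2 \<le> dist p q + dist q u2"
    "dist u1 v2 \<le> dist u1 p + dist p v2" "dist p v2 \<le> dist p q + dist q v2"
    "dist v1 u2 \<le> dist v1 p + dist p u2" "dist v1 v2 \<le> dist v1 p + dist p v2"
    by (rule dist_triangle)+
  moreover have "left_radius j + left_radius k \<le> dist u1 u2"
    "left_radius j + right_radius k \<le> dist u1 v2"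
    "right_radius j + left_radius k \<le> dist v1 u2"
    "right_radius j + right_radius k \<le> dist v1 v2"
    using radii_apart[OF assms(1)] radii_apart(2)[OF assms(1)[symmetric]]
    by (simp_all add: u1_def u2_def v1_def v2_def dist_commute add.commute)
  ultimately show ?thesis
    using assms(2,3) radii_nonneg[of j] radii_nonneg[of k]
    unfolding tent_def u1_def[symmetric] v1_def[symmetric] u2_def[symmetric] v2_def[symmetric] max_def
    by (smt (verit) dist_commute)
qed

sublocale disjoint_bumps tent
  by unfold_locales (fact tent_lipschitz, fact tents_apart)

lemma tent_other_pair:
  assumes "k \<noteq> j"
  shows "tent k (x (2*j)) = 0" "tent k (x (2*j+1)) = 0"
  using radii_apart[OF assms] radii_apart(2)[OF assms[symmetric]] radii_nonneg[of j] radii_nonneg[of k]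
  by (simp_all add: tent_def dist_commute max_def)

lemma tent_pair_diff: "tent j (x (2*j)) - tent j (x (2*j+1)) = pair_dist j"
proof -
  have "dist (x (2*j+1)) (x (2*j)) = pair_dist j" "dist (x (2*j)) (x (2*j+1)) = pair_dist j"
    by (simp_all add: pair_dist_def dist_commute)
  then show ?thesis using radii_nonneg[of j] radii_sum[of j] by (auto simp: tent_def max_def)
qed

lemma bump_map_pair_quotient:
  "(1 / dist (x (2*j)) (x (2*j+1))) *\<^sub>R (bump_map a e (x (2*j)) - bump_map a e (x (2*j+1)))
     = a j *\<^sub>R e j"
proof -
  have "bump_map a e (x (2*j)) = (a j * tent j (x (2*j))) *\<^sub>R e j"
    "bump_map a e (x (2*j+1)) = (a j * tent j (x (2*j+1))) *\<^sub>R e j"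
    using tent_other_pair by (simp_all add: bump_map_eq)
  then have "bump_map a e (x (2*j)) - bump_map a e (x (2*j+1))
      = (a j * (tent j (x (2*j)) - tent j (x (2*j+1)))) *\<^sub>R e j"
    by (simp add: right_diff_distrib scaleR_diff_left)
  then show ?thesis
    unfolding tent_pair_diff using pair_dist_pos[of j] by (simp add: pair_dist_def)
qed

lemma lip_norm_bump_map_weight:
  assumes "\<And>j. norm (e j) = 1"
  shows "lip_norm (bump_map weight e) = 1"
proof (rule lip_norm_eqI)
  show "norm (bump_map weight e p - bump_map weight e q) / dist p q \<le> 1" if "p \<noteq> q" for p q
    using bump_map_lipschitz[OF incseq_weight weight_nonneg less_imp_le[OF weight_less_one] assms]
    by (rule lipschitz_on_quotient_le[OF _ that])
  show "x (2*n) \<noteq> x (2*n+1)" for n using pair_dist_pos[of n] by (auto simp: pair_dist_def)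
  have "norm (bump_map weight e (x (2*n)) - bump_map weight e (x (2*n+1))) / dist (x (2*n)) (x (2*n+1))
      = weight n" for n
    using arg_cong[OF bump_map_pair_quotient[where a=weight and e=e and j=n], of norm] weight_nonneg[of n]
    by (simp add: assms)
  then show "(\<lambda>n. norm (bump_map weight e (x (2*n)) - bump_map weight e (x (2*n+1)))
      / dist (x (2*n)) (x (2*n+1))) \<longlonglongrightarrow> 1"
    using weight_tendsto_one by simp
qed

lemma bump_map_not_attains_norm_toward:
  assumes e: "riesz_sequence e"
  shows "\<not> attains_norm_toward (bump_map weight e) y"
proof
  assume "attains_norm_toward (bump_map weight e) y"
  then obtain p q where pq: "\<And>n. p n \<noteq> q n"
    and lim: "(\<lambda>n. (1 / dist (p n) (q n)) *\<^sub>R (bump_map weight e (p n) - bump_map weight e (q n))) \<longlonglongrightarrow> y"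
    and "norm y = lip_norm (bump_map weight e)"
    unfolding attains_norm_toward_def by blast
  then have "norm y = 1" using lip_norm_bump_map_weight[OF riesz_sequence_norm[OF e]] by simp
  moreover have "weighted_pair_combination weight e
      ((1 / dist (p n) (q n)) *\<^sub>R (bump_map weight e (p n) - bump_map weight e (q n)))" for n
    using bump_map_quotient[OF incseq_weight weight_nonneg pq] .
  ultimately show False
    using weighted_pair_combination_limit_norm_neq_one[OF e incseq_weight weight_less_one _ lim] by blast
qed


lemma exists_Lip0_not_in_A_set:
  assumes "\<not> (\<exists>S. finite S \<and> span S = (UNIV :: 'b::real_normed_vector set))"
  shows "\<exists>f :: 'a \<Rightarrow> 'b. f \<in> Lip0 x0 \<and> f \<notin> A_set x0"
proof -
  obtain e :: "nat \<Rightarrow> 'b" where e: "riesz_sequence e" using riesz_sequence_exists[OF assms] ..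
  define f where "f p = bump_map weight e p - bump_map weight e x0" for p
  have "1-lipschitz_on UNIV (bump_map weight e)"
    using bump_map_lipschitz[OF incseq_weight weight_nonneg less_imp_le[OF weight_less_one]]
      riesz_sequence_norm[OF e] by blast
  from lipschitz_on_diff[OF this lipschitz_on_constant] have "f \<in> Lip0 x0"
    unfolding Lip0_def f_def[abs_def] by auto
  moreover have "\<not> attains_norm_toward f y" for y
    using bump_map_not_attains_norm_toward[OF e]
    unfolding f_def[abs_def] attains_norm_toward_diff_const by blast
  ultimately show ?thesis unfolding A_set_def by blast
qed

end

lemma finite_span_A_set_eq_Lip0:
  fixes S :: "'b::real_normed_vector set" and p0 q0 x0 :: "'a::metric_space"
  assumes "finite S" "span S = UNIV" "p0 \<noteq> q0"
  shows "A_set x0 = (Lip0 x0 :: ('a \<Rightarrow> 'b) set)"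
  using finite_span_attains_norm_toward[OF assms(1,2) _ assms(3)]
  unfolding A_set_def Lip0_def by blast

theorem theorem2p7:
  fixes x0 :: "'a::complete_space" and x :: "nat \<Rightarrow> 'a"
  assumes "pairly_distanced x"
  shows "(A_set x0 = (Lip0 x0 :: ('a \<Rightarrow> 'b::banach) set)) \<longleftrightarrow>
         (\<exists>B. finite_dimensional_vector_space ((*\<^sub>R) :: real \<Rightarrow> 'b \<Rightarrow> 'b) B)"
  unfolding ex_finite_dimensional_vector_space_iff_finite_span
proof
  obtain r where "pairly_distanced_seq x r" using pairly_distancedE[OF assms] .
  then interpret pairly_distanced_seq x r .
  show "\<exists>S. finite S \<and> span S = (UNIV :: 'b set)" if "A_set x0 = (Lip0 x0 :: ('a \<Rightarrow> 'b) set)"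
    using exists_Lip0_not_in_A_set[of x0] that by blast
next
  assume "\<exists>S. finite S \<and> span S = (UNIV :: 'b set)"
  moreover have "x 0 \<noteq> x 1" using assms unfolding pairly_distanced_def by (metis inj_eq zero_neq_one)
  ultimately show "A_set x0 = (Lip0 x0 :: ('a \<Rightarrow> 'b) set)"
    using finite_span_A_set_eq_Lip0 by blast
qed

end
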